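(* Let $Y$ be a finite undirected graph with vertex set $\{1,\dots,n\}$, let $K$ be a finite set, and let $\mathfrak{F}_Y=(F_i)_{i=1}^n$ be a fixed sequence of $Y$-local functions $F_i\colon K^n\to K^n$. Then the number of cycle equivalence classes among the permutation SDS maps $[\mathfrak{F}_Y,\pi]$, as $\pi$ ranges over all permutations of the vertex set of $Y$, is at most $\kappa(Y)$.
   Context: Graphs are finite, simple and undirected. Each vertex $v$ has a state $y_v\in K$; $\mathbf{y}=(y_1,\dots,y_n)\in K^n$, and $\mathbf{y}[i]$ denotes the restriction of $\mathbf{y}$ to the vertex $i$ together with its neighbors in $Y$ (ordered increasingly). A $Y$-local function at $i$ is a map $F_i\colon K^n\to K^n$ of the form $F_i(y_1,\dots,y_n)=(y_1,\dots,y_{i-1},f_i(\mathbf{y}[i]),y_{i+1},\dots,y_n)$, where $f_i\colon K^{d(i)+1}\to K$ is an arbitrary function and $d(i)$ is the degree of $i$. Let $S_Y$ be the set of permutations $\pi=(\pi_1,\dots,\pi_n)$ of the vertex set, written as words in which every vertex occurs exactly once. The permutation SDS map is $[\mathfrak{F}_Y,\pi]=F_{\pi_n}\circ\cdots\circ F_{\pi_1}$. For a map $\phi$ of a finite set to itself, $\mathrm{Per}(\phi)$ is its set of periodic points. Two self-maps $\phi,\psi$ of finite sets are cycle equivalent if there is a bijection $h\colon \mathrm{Per}(\phi)\to\mathrm{Per}(\psi)$ with $\psi|_{\mathrm{Per}(\psi)}\circ h=h\circ\phi|_{\mathrm{Per}(\phi)}$. Let $\sim_Y$ be the equivalence relation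 on $S_Y$ generated by relating $\pi$ and $\pi'$ whenever they differ exactly by a transposition of the entries in two consecutive positions $k,k+1$ and $\{\pi_k,\pi_{k+1}\}$ is not an edge of $Y$; write $[\pi]_Y$ for the class of $\pi$. Let $\boldsymbol{\sigma}_1(\pi)=(\pi_2,\dots,\pi_n,\pi_1)$. The graph $C(Y)$ has vertex set $S_Y/{\sim_Y}$ and edges $\{[\pi]_Y,[\boldsymbol{\sigma}_1(\pi)]_Y\}$ for $\pi\in S_Y$. The number of connected components of $C(Y)$ is denoted $\kappa(Y)$. *)

theory Defs
  imports "HOL-Combinatorics.Multiset_Permutations" "Graph_Theory.Graph_Theory"
begin

text \<open>
  Undirected graphs follow the convention of the session Graph_Theory: both orientations of
  every edge are present as arcs, and a finite simple undirected graph is a \<^locale>\<open>pair_graph\<close>.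
\<close>

subsection \<open>Sequential dynamical systems\<close>

text \<open>
  The state space \<open>K\<^sup>n\<close> is the set of extensional functions from the vertex set to \<open>K\<close>.
\<close>

definition states :: "'v pair_pre_digraph \<Rightarrow> 'k set \<Rightarrow> ('v \<Rightarrow> 'k) set" where
  "states Y K = pverts Y \<rightarrow>\<^sub>E K"

definition closed_nbhd :: "'v pair_pre_digraph \<Rightarrow> 'v \<Rightarrow> 'v set" where
  "closed_nbhd Y i = insert i {j. (i, j) \<in> parcs Y}"

definition local_state :: "'v::linorder pair_pre_digraph \<Rightarrow> ('v \<Rightarrow> 'k) \<Rightarrow> 'v \<Rightarrow> 'k list" where
  "local_state Y y i = map y (sorted_list_of_set (closed_nbhd Y i))"

definition local_function ::
  "'v::linorder pair_pre_digraph \<Rightarrow> 'k set \<Rightarrow> 'v \<Rightarrow> (('v \<Rightarrow> 'k) \<Rightarrow> ('v \<Rightarrow> 'k)) \<Rightarrow> bool" where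
  "local_function Y K i \<phi> \<longleftrightarrow>
     (\<exists>f :: 'k list \<Rightarrow> 'k.
        f \<in> {ys. set ys \<subseteq> K \<and> length ys = out_degree (with_proj Y) i + 1} \<rightarrow> K \<and>
        (\<forall>y \<in> states Y K. \<phi> y = y(i := f (local_state Y y i))))"

text \<open>
  \<^term>\<open>fold F [p1, p2, p3]\<close> applies \<open>F p1\<close> first. Restricting to the state space makes two SDS
  maps equal exactly when they agree there.
\<close>

definition sds_map :: "'v pair_pre_digraph \<Rightarrow> 'k set \<Rightarrow> ('v \<Rightarrow> ('v \<Rightarrow> 'k) \<Rightarrow> ('v \<Rightarrow> 'k)) \<Rightarrow>
    'v list \<Rightarrow> ('v \<Rightarrow> 'k) \<Rightarrow> ('v \<Rightarrow> 'k)" where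
  "sds_map Y K F p = restrict (fold F p) (states Y K)"

definition sds_maps :: "'v pair_pre_digraph \<Rightarrow> 'k set \<Rightarrow> ('v \<Rightarrow> ('v \<Rightarrow> 'k) \<Rightarrow> ('v \<Rightarrow> 'k)) \<Rightarrow>
    (('v \<Rightarrow> 'k) \<Rightarrow> ('v \<Rightarrow> 'k)) set" where
  "sds_maps Y K F = sds_map Y K F ` permutations_of_set (pverts Y)"

subsection \<open>Cycle equivalence\<close>

definition periodic_points :: "'a set \<Rightarrow> ('a \<Rightarrow> 'a) \<Rightarrow> 'a set" where
  "periodic_points X \<phi> = {x \<in> X. \<exists>m>0. (\<phi> ^^ m) x = x}"

definition cycle_equivalent :: "'a set \<Rightarrow> ('a \<Rightarrow> 'a) \<Rightarrow> 'b set \<Rightarrow> ('b \<Rightarrow> 'b) \<Rightarrow> bool" where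
  "cycle_equivalent X \<phi> Z \<psi> \<longleftrightarrow>
     (\<exists>h. bij_betw h (periodic_points X \<phi>) (periodic_points Z \<psi>) \<and>
          (\<forall>x \<in> periodic_points X \<phi>. \<psi> (h x) = h (\<phi> x)))"

definition cycle_equivalence_classes ::
  "'v pair_pre_digraph \<Rightarrow> 'k set \<Rightarrow> ('v \<Rightarrow> ('v \<Rightarrow> 'k) \<Rightarrow> ('v \<Rightarrow> 'k)) \<Rightarrow>
    (('v \<Rightarrow> 'k) \<Rightarrow> ('v \<Rightarrow> 'k)) set set" where
  "cycle_equivalence_classes Y K F =
     sds_maps Y K F //
       {(\<phi>, \<psi>). \<phi> \<in> sds_maps Y K F \<and> \<psi> \<in> sds_maps Y K F \<and>
                cycle_equivalent (states Y K) \<phi> (states Y K) \<psi>}"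

subsection \<open>The graph \<open>C(Y)\<close>\<close>

definition adjacent_swap :: "'v pair_pre_digraph \<Rightarrow> 'v list \<Rightarrow> 'v list \<Rightarrow> bool" where
  "adjacent_swap Y p q \<longleftrightarrow>
     p \<in> permutations_of_set (pverts Y) \<and>
     (\<exists>k. Suc k < length p \<and> (p ! k, p ! Suc k) \<notin> parcs Y \<and>
          q = p[k := p ! Suc k, Suc k := p ! k])"

definition perm_rel :: "'v pair_pre_digraph \<Rightarrow> 'v list rel" where
  "perm_rel Y = {(p, q). p \<in> permutations_of_set (pverts Y) \<and>
     q \<in> permutations_of_set (pverts Y) \<and> equivclp (adjacent_swap Y) p q}"

definition perm_class :: "'v pair_pre_digraph \<Rightarrow> 'v list \<Rightarrow> 'v list set" where
  "perm_class Y p = perm_rel Y `` {p}"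

text \<open>
  \<open>C(Y)\<close> may have loops, which occur when \<open>p\<close> and \<^term>\<open>rotate1 p\<close> are equivalent.
\<close>

definition C_graph :: "'v pair_pre_digraph \<Rightarrow> 'v list set pair_pre_digraph" where
  "C_graph Y =
     \<lparr> pverts = permutations_of_set (pverts Y) // perm_rel Y,
       parcs = (\<Union>p \<in> permutations_of_set (pverts Y).
                  {(perm_class Y p, perm_class Y (rotate1 p)),
                   (perm_class Y (rotate1 p), perm_class Y p)}) \<rparr>"

definition connected_components :: "('a, 'b) pre_digraph \<Rightarrow> ('a, 'b) pre_digraph set" where
  "connected_components G = {H. pre_digraph.max_subgraph G connected H}"

definition \<kappa> :: "'v pair_pre_digraph \<Rightarrow> nat" where
  "\<kappa> Y = card (connected_components (with_proj (C_graph Y)))"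

end

theory Submission
  imports Defs
begin

text \<open>
  The SDS map depends only on the class of the permutation, since local functions at non-adjacent
  vertices commute. Rotating a permutation replaces \<open>g \<circ> f\<close> by \<open>f \<circ> g\<close>, where \<open>f\<close> is the first
  local function applied, and \<open>f\<close> itself is then a cycle equivalence. Hence the cycle equivalence
  class is constant on each connected component of \<open>C(Y)\<close>.
\<close>

section \<open>Periodic points and cycle equivalence\<close>

lemma funpow_mem: "f \<in> X \<rightarrow> X \<Longrightarrow> x \<in> X \<Longrightarrow> (f ^^ m) x \<in> X"
  by (induction m) auto

lemma funpow_intertwine:
  assumes "\<phi> \<in> X \<rightarrow> X" and "\<And>x. x \<in> X \<Longrightarrow> f (\<phi> x) = \<psi> (f x)" and "x \<in> X"
  shows "f ((\<phi> ^^ m) x) = (\<psi> ^^ m) (f x)"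
proof (induction m)
  case (Suc m)
  show ?case using assms(2)[of "(\<phi> ^^ m) x"] funpow_mem[OF assms(1,3), of m] Suc by simp
qed simp

text \<open>A semiconjugacy carries the orbit of \<open>x\<close> to the orbit of
  \<open>f x\<close>, so a return time of \<open>x\<close> is also a return time of
  \<open>f x\<close>.\<close>

lemma periodic_points_intertwine:
  assumes "\<phi> \<in> X \<rightarrow> X" and "f \<in> X \<rightarrow> Z" and "\<And>x. x \<in> X \<Longrightarrow> f (\<phi> x) = \<psi> (f x)"
  shows "f \<in> periodic_points X \<phi> \<rightarrow> periodic_points Z \<psi>"
proof
  fix x assume "x \<in> periodic_points X \<phi>"
  then obtain m where m: "m > 0" "(\<phi> ^^ m) x = x" and x: "x \<in> X"
    by (auto simp: periodic_points_def)
  have "(\<psi> ^^ m) (f x) = f x"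
    using funpow_intertwine[of \<phi> X f \<psi> x m] assms(1,3) x m(2) by simp
  with m(1) x assms(2) show "f x \<in> periodic_points Z \<psi>"
    by (auto simp: periodic_points_def)
qed

lemma periodic_points_invariant:
  "\<phi> \<in> X \<rightarrow> X \<Longrightarrow> \<phi> \<in> periodic_points X \<phi> \<rightarrow> periodic_points X \<phi>"
  by (rule periodic_points_intertwine) auto

text \<open>Two periodic points have a common positive return time, the product of their periods.
  Iterating \<open>\<phi>\<close> one time fewer than this product undoes \<open>\<phi>\<close> at
  both points.\<close>

lemma inj_on_periodic_points:
  assumes "\<phi> \<in> X \<rightarrow> X"
  shows "inj_on \<phi> (periodic_points X \<phi>)"
proof (rule inj_onI)
  fix x y
  assume "x \<in> periodic_points X \<phi>" "y \<in> periodic_points X \<phi>" and eq: "\<phi> x = \<phi> y"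
  then obtain k l where k: "k > 0" "(\<phi> ^^ k) x = x" and l: "l > 0" "(\<phi> ^^ l) y = y"
    by (auto simp: periodic_points_def)
  have fix_mult: "(\<phi> ^^ (a * b)) z = z" if "(\<phi> ^^ a) z = z" for a b z
    using that by (induction b) (auto simp: funpow_add)
  obtain m where m: "k * l = Suc m"
    using k(1) l(1) by (metis gr0_implies_Suc nat_0_less_mult_iff)
  have "x = (\<phi> ^^ m) (\<phi> x)"
    using fix_mult[OF k(2), of l] m by (simp add: funpow_swap1)
  also have "\<dots> = (\<phi> ^^ m) (\<phi> y)" by (simp add: eq)
  also have "\<dots> = y"
    using fix_mult[OF l(2), of k] m by (simp add: funpow_swap1 mult.commute)
  finally show "x = y" .
qed

lemma image_periodic_points:
  assumes "\<phi> \<in> X \<rightarrow> X"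
  shows "\<phi> ` periodic_points X \<phi> = periodic_points X \<phi>"
proof
  show "\<phi> ` periodic_points X \<phi> \<subseteq> periodic_points X \<phi>"
    using periodic_points_invariant[OF assms] by auto
  show "periodic_points X \<phi> \<subseteq> \<phi> ` periodic_points X \<phi>"
  proof
    fix x assume x: "x \<in> periodic_points X \<phi>"
    then obtain m where "m > 0" "(\<phi> ^^ m) x = x"
      by (auto simp: periodic_points_def)
    then have "x = \<phi> ((\<phi> ^^ (m - 1)) x)" by (cases m) auto
    \<comment> \<open>The preimage found on the orbit is itself periodic: \<open>funpow_mem\<close>
      is applied with the periodic points as the invariant set.\<close>
    moreover have "(\<phi> ^^ (m - 1)) x \<in> periodic_points X \<phi>"
      using funpow_mem[OF periodic_points_invariant[OF assms] x] .
    ultimately show "x \<in> \<phi> ` periodic_points X \<phi>" by (rule image_eqI)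
  qed
qed

section \<open>Cycle equivalence: equivalence laws and interchanging two factors\<close>

lemma cycle_equivalent_refl: "cycle_equivalent X \<phi> X \<phi>"
  unfolding cycle_equivalent_def by (rule exI[of _ id]) auto

lemma cycle_equivalent_sym:
  assumes "\<phi> \<in> X \<rightarrow> X" and "cycle_equivalent X \<phi> Z \<psi>"
  shows "cycle_equivalent Z \<psi> X \<phi>"
proof -
  let ?P = "periodic_points X \<phi>" and ?Q = "periodic_points Z \<psi>"
  obtain h where h: "bij_betw h ?P ?Q" "\<And>x. x \<in> ?P \<Longrightarrow> \<psi> (h x) = h (\<phi> x)"
    using assms(2) by (auto simp: cycle_equivalent_def)
  let ?g = "inv_into ?P h"
  have g: "bij_betw ?g ?Q ?P" using h(1) by (rule bij_betw_inv_into)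
  moreover have "\<phi> (?g z) = ?g (\<psi> z)" if z: "z \<in> ?Q" for z
  proof -
    have gz: "?g z \<in> ?P" "h (?g z) = z"
      using z g h(1) by (auto simp: bij_betw_def inv_into_into f_inv_into_f)
    have "\<psi> z = h (\<phi> (?g z))" using h(2)[OF gz(1)] gz(2) by simp
    \<comment> \<open>The inverse of \<open>h\<close> cancels \<open>h\<close> only on periodic
      points of \<open>\<phi>\<close>; this is where \<open>\<phi>\<close> must map \<open>X\<close>
      into itself.\<close>
    moreover have "\<phi> (?g z) \<in> ?P" using periodic_points_invariant[OF assms(1)] gz(1) by auto
    ultimately show ?thesis using h(1) by (simp add: bij_betw_def)
  qed
  ultimately show ?thesis by (auto simp: cycle_equivalent_def)
qed

lemma cycle_equivalent_trans:
  assumes "cycle_equivalent X \<phi> Z \<psi>" and "cycle_equivalent Z \<psi> W \<chi>"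
  shows "cycle_equivalent X \<phi> W \<chi>"
proof -
  obtain h where h: "bij_betw h (periodic_points X \<phi>) (periodic_points Z \<psi>)"
      "\<And>x. x \<in> periodic_points X \<phi> \<Longrightarrow> \<psi> (h x) = h (\<phi> x)"
    using assms(1) by (auto simp: cycle_equivalent_def)
  obtain g where g: "bij_betw g (periodic_points Z \<psi>) (periodic_points W \<chi>)"
      "\<And>z. z \<in> periodic_points Z \<psi> \<Longrightarrow> \<chi> (g z) = g (\<psi> z)"
    using assms(2) by (auto simp: cycle_equivalent_def)
  have "\<chi> ((g \<circ> h) x) = (g \<circ> h) (\<phi> x)" if x: "x \<in> periodic_points X \<phi>" for x
    using g(2)[of "h x"] h(2)[OF x] bij_betwE[OF h(1)] x by simp
  with bij_betw_trans[OF h(1) g(1)] show ?thesis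
    unfolding cycle_equivalent_def by blast
qed

text \<open>The conjugating bijection is \<open>f\<close> itself. It semiconjugates
  \<open>g \<circ> f\<close> to \<open>f \<circ> g\<close>, and \<open>g\<close> does so in the
  other direction, hence both preserve periodicity. On periodic points \<open>f\<close> is injective
  because \<open>g \<circ> f\<close> is, and surjective because \<open>f \<circ> g\<close>
  is.\<close>

lemma cycle_equivalent_swap_comp:
  assumes f: "f \<in> X \<rightarrow> Z" and g: "g \<in> Z \<rightarrow> X"
    and \<phi>: "\<And>x. x \<in> X \<Longrightarrow> \<phi> x = g (f x)" and \<psi>: "\<And>z. z \<in> Z \<Longrightarrow> \<psi> z = f (g z)"
  shows "cycle_equivalent X \<phi> Z \<psi>"
proof -
  let ?P = "periodic_points X \<phi>" and ?Q = "periodic_points Z \<psi>"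
  have \<phi>X: "\<phi> \<in> X \<rightarrow> X" and \<psi>Z: "\<psi> \<in> Z \<rightarrow> Z" using f g \<phi> \<psi> by auto
  have comm: "f (\<phi> x) = \<psi> (f x)" if "x \<in> X" for x
    using that \<phi> \<psi> funcset_mem[OF f that] by simp
  have fP: "f \<in> ?P \<rightarrow> ?Q" by (rule periodic_points_intertwine[OF \<phi>X f comm])
  have gQ: "g \<in> ?Q \<rightarrow> ?P"
    by (rule periodic_points_intertwine[OF \<psi>Z g]) (simp add: \<phi> \<psi> funcset_mem[OF g])
  have sub: "?P \<subseteq> X" "?Q \<subseteq> Z" by (auto simp: periodic_points_def)
  have "inj_on f ?P"
  proof (rule inj_onI)
    fix x y assume xy: "x \<in> ?P" "y \<in> ?P" "f x = f y"
    then have "\<phi> x = \<phi> y" using \<phi> sub(1) by (metis subsetD)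
    then show "x = y" using inj_on_periodic_points[OF \<phi>X] xy(1,2) by (auto dest: inj_onD)
  qed
  moreover have "?Q \<subseteq> f ` ?P"
  proof
    fix z assume "z \<in> ?Q"
    then obtain w where "w \<in> ?Q" "z = \<psi> w" using image_periodic_points[OF \<psi>Z] by blast
    then have "z = f (g w)" "g w \<in> ?P"
      using \<psi> subsetD[OF sub(2)] funcset_mem[OF gQ] by simp_all
    then show "z \<in> f ` ?P" by (rule image_eqI)
  qed
  ultimately have "bij_betw f ?P ?Q" using fP by (auto simp: bij_betw_def)
  with comm sub(1) show ?thesis unfolding cycle_equivalent_def by (metis subsetD)
qed

section \<open>SDS maps\<close>

text \<open>Names the relation by which \<open>cycle_equivalence_classes\<close> takes the
  quotient.\<close>

definition cycle_rel ::
  "'v pair_pre_digraph \<Rightarrow> 'k set \<Rightarrow> ('v \<Rightarrow> ('v \<Rightarrow> 'k) \<Rightarrow> ('v \<Rightarrow> 'k)) \<Rightarrow>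
    (('v \<Rightarrow> 'k) \<Rightarrow> ('v \<Rightarrow> 'k)) rel" where
  "cycle_rel Y K F = {(\<phi>, \<psi>). \<phi> \<in> sds_maps Y K F \<and> \<psi> \<in> sds_maps Y K F \<and>
                        cycle_equivalent (states Y K) \<phi> (states Y K) \<psi>}"

context
  fixes Y :: "'v::linorder pair_pre_digraph" and K :: "'k set"
    and F :: "'v \<Rightarrow> ('v \<Rightarrow> 'k) \<Rightarrow> ('v \<Rightarrow> 'k)"
  assumes graph: "pair_graph Y"
    and local: "\<And>i. i \<in> pverts Y \<Longrightarrow> local_function Y K i (F i)"
begin

interpretation Y: pair_graph Y by (rule graph)

section \<open>Local states and local functions\<close>

lemma finite_closed_nbhd: "finite (closed_nbhd Y i)"
proof -
  have "{j. (i, j) \<in> parcs Y} \<subseteq> pverts Y" by (auto dest: Y.in_arcsD2)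
  then show ?thesis by (auto simp: closed_nbhd_def intro: finite_subset Y.pair_finite_verts)
qed

text \<open>Neighbors of \<open>i\<close> correspond to out-arcs via \<open>Pair i\<close>, and the
  summand 1 counts \<open>i\<close>, which is not its own neighbor since there are no loops.
  Together with \<open>set_local_state\<close> this puts local states into the domain required in
  \<open>local_function\<close>.\<close>

lemma length_local_state: "length (local_state Y y i) = out_degree (with_proj Y) i + 1"
proof -
  have "out_arcs (with_proj Y) i = Pair i ` {j. (i, j) \<in> parcs Y}"
    by (auto simp: out_arcs_def)
  then have "out_degree (with_proj Y) i = card {j. (i, j) \<in> parcs Y}"
    by (simp add: out_degree_def card_image inj_on_def)
  moreover have "i \<notin> {j. (i, j) \<in> parcs Y}" using Y.pair_no_loops by fastforce
  ultimately show ?thesis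
    using finite_closed_nbhd[of i] by (simp add: local_state_def closed_nbhd_def)
qed

lemma set_local_state:
  assumes "i \<in> pverts Y" "y \<in> states Y K"
  shows "set (local_state Y y i) \<subseteq> K"
proof -
  have "closed_nbhd Y i \<subseteq> pverts Y"
    using assms(1) by (auto simp: closed_nbhd_def dest: Y.in_arcsD2)
  with assms(2) show ?thesis
    using finite_closed_nbhd[of i] by (auto simp: local_state_def states_def)
qed

lemma local_state_upd: "j \<notin> closed_nbhd Y i \<Longrightarrow> local_state Y (y(j := a)) i = local_state Y y i"
  using finite_closed_nbhd[of i] by (auto simp: local_state_def)

text \<open>Provides the vertex function with its domain conditions already discharged, so that
  later arguments need only know that they start from a state.\<close>

lemma local_functionE:
  assumes "i \<in> pverts Y"
  obtains f where "\<And>y. y \<in> states Y K \<Longrightarrow> F i y = y(i := f (local_state Y y i))"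
    and "\<And>y. y \<in> states Y K \<Longrightarrow> f (local_state Y y i) \<in> K"
proof -
  obtain f where
    f: "f \<in> {ys. set ys \<subseteq> K \<and> length ys = out_degree (with_proj Y) i + 1} \<rightarrow> K"
      "\<And>y. y \<in> states Y K \<Longrightarrow> F i y = y(i := f (local_state Y y i))"
    using local[OF assms] unfolding local_function_def by blast
  show thesis
  proof (rule that[OF f(2)])
    fix y assume "y \<in> states Y K"
    then show "f (local_state Y y i) \<in> K"
      by (intro funcset_mem[OF f(1)]) (simp add: set_local_state[OF assms] length_local_state)
  qed
qed

lemma upd_in_states: "i \<in> pverts Y \<Longrightarrow> y \<in> states Y K \<Longrightarrow> a \<in> K \<Longrightarrow> y(i := a) \<in> states Y K"
  by (auto simp: states_def PiE_def extensional_def)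

lemma local_in_states: "i \<in> pverts Y \<Longrightarrow> y \<in> states Y K \<Longrightarrow> F i y \<in> states Y K"
  by (rule local_functionE[of i]) (simp_all add: upd_in_states)

lemma fold_in_states: "set p \<subseteq> pverts Y \<Longrightarrow> y \<in> states Y K \<Longrightarrow> fold F p y \<in> states Y K"
  by (induction p arbitrary: y) (auto simp: local_in_states)

text \<open>Neither vertex lies in the closed neighborhood of the other, so neither update changes
  what the other one reads, and updates of distinct coordinates commute. The hypothesis excludes one
  orientation of the arc; symmetry of \<open>Y\<close> excludes the other.\<close>

lemma local_commute:
  assumes "i \<in> pverts Y" "j \<in> pverts Y" "i \<noteq> j" "(i, j) \<notin> parcs Y" "y \<in> states Y K"
  shows "F i (F j y) = F j (F i y)"
proof -
  obtain f where f: "\<And>y. y \<in> states Y K \<Longrightarrow> F i y = y(i := f (local_state Y y i))"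
    by (rule local_functionE[OF assms(1)]) blast
  obtain g where g: "\<And>y. y \<in> states Y K \<Longrightarrow> F j y = y(j := g (local_state Y y j))"
    by (rule local_functionE[OF assms(2)]) blast
  have "(j, i) \<notin> parcs Y"
    using Y.pair_sym_arcs assms(4) by (auto simp: symmetric_def sym_def)
  with assms(3,4) have "j \<notin> closed_nbhd Y i" "i \<notin> closed_nbhd Y j"
    by (auto simp: closed_nbhd_def)
  moreover have "F i y \<in> states Y K" "F j y \<in> states Y K"
    using local_in_states assms by auto
  ultimately show ?thesis
    using assms(3,5) by (simp add: f g local_state_upd fun_upd_twist)
qed

section \<open>Effect of swaps and rotations on the SDS map\<close>

lemma sds_map_adjacent_swap:
  assumes "adjacent_swap Y p q"
  shows "sds_map Y K F p = sds_map Y K F q"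
proof -
  obtain k where p: "p \<in> permutations_of_set (pverts Y)" and k: "Suc k < length p"
    and nadj: "(p ! k, p ! Suc k) \<notin> parcs Y" and q: "q = p[k := p ! Suc k, Suc k := p ! k]"
    using assms by (auto simp: adjacent_swap_def)
  define u v a b where "u = take k p" "v = drop (Suc (Suc k)) p" "a = p ! k" "b = p ! Suc k"
  note defs = this
  have p_eq: "p = u @ a # b # v"
    using k by (simp add: defs Cons_nth_drop_Suc)
  have len: "length u = k" using k by (simp add: defs)
  have q_eq: "q = u @ b # a # v"
    unfolding q defs(3,4)[symmetric] by (simp add: p_eq list_update_append len)
  have set_p: "set p = pverts Y" "distinct p" using p by (auto simp: permutations_of_set_def)
  have "fold F p y = fold F q y" if y: "y \<in> states Y K" for y
  proof -
    \<comment> \<open>The local functions at \<open>a\<close> and \<open>b\<close> commute only on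
      states, so the common prefix \<open>u\<close> must first be seen to lead to a state. The
      common suffix \<open>v\<close> is then applied to equal states.\<close>
    have "fold F u y \<in> states Y K" using set_p y by (intro fold_in_states) (auto simp: p_eq)
    moreover have "a \<in> pverts Y" "b \<in> pverts Y" "a \<noteq> b" using set_p by (auto simp: p_eq)
    moreover have "(a, b) \<notin> parcs Y" using nadj by (simp add: defs)
    ultimately have "F b (F a (fold F u y)) = F a (F b (fold F u y))"
      by (metis local_commute)
    then show ?thesis by (simp add: p_eq q_eq)
  qed
  then show ?thesis by (auto simp: sds_map_def restrict_def)
qed

text \<open>Equality of maps is symmetric and transitive, so invariance under a single swap extends
  to the generated equivalence.\<close>

lemma sds_map_perm_rel:
  assumes "(p, q) \<in> perm_rel Y"
  shows "sds_map Y K F p = sds_map Y K F q"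
proof -
  have "equivclp (adjacent_swap Y) p q" using assms by (simp add: perm_rel_def)
  then show ?thesis
    by (induction rule: equivclp_induct) (auto dest: sds_map_adjacent_swap)
qed

lemma sds_map_in_states:
  "p \<in> permutations_of_set (pverts Y) \<Longrightarrow> sds_map Y K F p \<in> states Y K \<rightarrow> states Y K"
  by (auto simp: sds_map_def permutations_of_set_def intro: fold_in_states)

text \<open>For \<open>p = a # r\<close> the two maps are the composites of \<open>F a\<close> and
  \<open>fold F r\<close> in the two orders, so \<open>cycle_equivalent_swap_comp\<close> applies.
  The empty word is its own rotation.\<close>

lemma cycle_equivalent_rotate1:
  assumes "p \<in> permutations_of_set (pverts Y)"
  shows "cycle_equivalent (states Y K) (sds_map Y K F p)
           (states Y K) (sds_map Y K F (rotate1 p))"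
proof (cases p)
  case Nil
  then show ?thesis by (simp add: cycle_equivalent_refl)
next
  case (Cons a r)
  have "set p = pverts Y" using assms by (simp add: permutations_of_set_def)
  then have a: "a \<in> pverts Y" and r: "set r \<subseteq> pverts Y" by (auto simp: Cons)
  show ?thesis
    by (rule cycle_equivalent_swap_comp[where f = "F a" and g = "fold F r"])
      (use a r in \<open>auto simp: Cons sds_map_def intro: local_in_states fold_in_states\<close>)
qed

lemma equiv_cycle_rel: "equiv (sds_maps Y K F) (cycle_rel Y K F)"
proof (rule equivI)
  show "cycle_rel Y K F \<subseteq> sds_maps Y K F \<times> sds_maps Y K F" by (auto simp: cycle_rel_def)
  show "refl_on (sds_maps Y K F) (cycle_rel Y K F)"
    by (auto simp: refl_on_def cycle_rel_def cycle_equivalent_refl)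
  show "sym (cycle_rel Y K F)"
    using cycle_equivalent_sym[OF sds_map_in_states]
    by (auto simp: sym_def cycle_rel_def sds_maps_def)
  show "trans (cycle_rel Y K F)"
    unfolding trans_def cycle_rel_def using cycle_equivalent_trans by blast
qed

end

section \<open>Components of \<open>C(Y)\<close>\<close>

lemma equiv_perm_rel: "equiv (permutations_of_set (pverts Y)) (perm_rel Y)"
proof (rule equivI)
  show "perm_rel Y \<subseteq> permutations_of_set (pverts Y) \<times> permutations_of_set (pverts Y)"
    by (auto simp: perm_rel_def)
  show "refl_on (permutations_of_set (pverts Y)) (perm_rel Y)"
    by (auto simp: refl_on_def perm_rel_def)
  show "sym (perm_rel Y)"
    unfolding perm_rel_def by (rule symI) (simp, elim conjE, erule equivclp_sym)
  show "trans (perm_rel Y)"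
    unfolding perm_rel_def by (rule transI) (simp, elim conjE, erule (1) equivclp_trans)
qed

lemma rotate1_permutation:
  "p \<in> permutations_of_set A \<Longrightarrow> rotate1 p \<in> permutations_of_set A"
  by (simp add: permutations_of_set_def)

lemma perm_class_in_quotient:
  "p \<in> permutations_of_set (pverts Y) \<Longrightarrow>
     perm_class Y p \<in> permutations_of_set (pverts Y) // perm_rel Y"
  by (simp add: perm_class_def quotientI)

text \<open>Finiteness secures both the existence of maximal connected subgraphs and the finiteness
  of their number. Arcs end in vertices because a rotated permutation is again a
  permutation.\<close>

lemma fin_digraph_C_graph: "fin_digraph (with_proj (C_graph Y))"
proof
  have fin: "finite (permutations_of_set (pverts Y))" by simp
  show "finite (verts (with_proj (C_graph Y)))"
    using fin by (auto simp: C_graph_def quotient_def)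
  show "finite (arcs (with_proj (C_graph Y)))"
    using fin by (auto simp: C_graph_def)
qed (auto simp: C_graph_def perm_class_in_quotient rotate1_permutation)

section \<open>Maximal subgraphs of finite digraphs\<close>

lemma compatible_eqI:
  "compatible H H' \<Longrightarrow> verts H = verts H' \<Longrightarrow> arcs H = arcs H' \<Longrightarrow> H = H'"
  for H H' :: "('a, 'b) pre_digraph"
  by (cases H, cases H') (simp add: compatible_def)

text \<open>A subgraph inherits its tail and head functions from \<open>G\<close>, so its vertex and
  arc sets determine it.\<close>

lemma (in fin_digraph) finite_subgraphs: "finite {H. subgraph H G}"
proof (rule inj_on_finite)
  show "inj_on (\<lambda>H. (verts H, arcs H)) {H. subgraph H G}"
    by (rule inj_onI, rule compatible_eqI) (simp_all add: subgraph_def compatible_def)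
  show "(\<lambda>H. (verts H, arcs H)) ` {H. subgraph H G} \<subseteq> Pow (verts G) \<times> Pow (arcs G)"
    by (auto simp: subgraph_def)
qed (simp add: finite_verts finite_arcs)

text \<open>Among the subgraphs of \<open>G\<close> that contain \<open>H\<close> and satisfy
  \<open>P\<close>, one with the greatest total number of vertices and arcs is maximal for
  inclusion.\<close>

lemma (in fin_digraph) max_subgraph_exists:
  assumes "subgraph H G" "P H"
  obtains H' where "max_subgraph P H'" "subgraph H H'"
proof -
  let ?A = "\<lambda>H'. subgraph H H' \<and> subgraph H' G \<and> P H'"
  let ?size = "\<lambda>H'. card (verts H') + card (arcs H')"
  have "\<forall>H'. ?A H' \<longrightarrow> ?size H' < Suc (card (verts G) + card (arcs G))"
    by (simp add: subgraph_def add_mono card_mono less_Suc_eq_le)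
  moreover have "?A H" using assms by (simp add: subgraph_def compatible_def)
  ultimately have "\<exists>M. ?A M \<and> (\<forall>H'. ?A H' \<longrightarrow> ?size H' \<le> ?size M)"
    by (intro ex_has_greatest_nat)
  then obtain M where M: "?A M" "\<And>H'. ?A H' \<Longrightarrow> ?size H' \<le> ?size M"
    by metis
  have "\<not> (subgraph N G \<and> P N)" if "N \<noteq> M" "subgraph M N" for N
  proof
    assume N: "subgraph N G \<and> P N"
    have "?A N" using N M(1) subgraph_trans[OF _ that(2)] by simp
    then have le: "?size N \<le> ?size M" by (rule M(2))
    have fin: "finite (verts N)" "finite (arcs N)"
      using N finite_verts finite_arcs by (auto simp: subgraph_def intro: finite_subset)
    have sub: "verts M \<subseteq> verts N" "arcs M \<subseteq> arcs N"
      using that(2) by (auto simp: subgraph_def)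
    have "card (verts M) \<le> card (verts N)" "card (arcs M) \<le> card (arcs N)"
      using fin sub by (simp_all add: card_mono)
    \<comment> \<open>Both cardinalities grow weakly from \<open>M\<close> to \<open>N\<close> while
      their sum does not increase, so each is unchanged.\<close>
    then have "verts M = verts N" "arcs M = arcs N"
      using le by (simp_all add: card_subset_eq fin sub)
    then show False
      using that compatible_eqI[of N M] by (simp add: subgraph_def)
  qed
  then have "max_subgraph P M" using M(1) by (simp add: max_subgraph_def)
  then show thesis using conjunct1[OF M(1)] by (rule that)
qed

text \<open>The single vertex without arcs is a connected subgraph, which extends to a maximal one.
  It keeps the tail and head functions of \<open>G\<close>, as compatibility demands.\<close>

lemma (in fin_digraph) vertex_in_component:
  assumes "u \<in> verts G"
  obtains H where "max_subgraph connected H" "u \<in> verts H"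
proof -
  let ?U = "\<lparr>verts = {u}, arcs = {}, tail = tail G, head = head G\<rparr>"
  have "subgraph ?U G"
    using assms wf_digraph_axioms by (simp add: subgraph_def compatible_def wf_digraph_def)
  moreover have "connected ?U"
    by (simp add: connected_def strongly_connected_def mk_symmetric_def reachable_def)
  ultimately obtain H where "max_subgraph connected H" "subgraph ?U H"
    by (rule max_subgraph_exists)
  with that show thesis by (simp add: subgraph_def)
qed

text \<open>Walk through \<open>H\<close> from the class of \<open>p\<close> to that of
  \<open>q\<close>. Changing the representative at a vertex preserves the SDS map, and crossing an
  arc is a rotation or its inverse, which preserves the cycle class.\<close>

lemma cycle_rel_component:
  assumes "pair_graph Y" and "\<And>i. i \<in> pverts Y \<Longrightarrow> local_function Y K i (F i)"
    and H: "subgraph H (with_proj (C_graph Y))" "connected H"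
    and p: "p \<in> permutations_of_set (pverts Y)" "perm_class Y p \<in> verts H"
    and q: "q \<in> permutations_of_set (pverts Y)" "perm_class Y q \<in> verts H"
  shows "(sds_map Y K F p, sds_map Y K F q) \<in> cycle_rel Y K F"
proof -
  let ?P = "permutations_of_set (pverts Y)" and ?\<phi> = "sds_map Y K F" and ?R = "cycle_rel Y K F"
  have eqv: "refl_on (sds_maps Y K F) ?R" "sym ?R" "trans ?R"
    using equiv_cycle_rel[OF assms(1,2)] by (simp_all add: equiv_def)
  have same_class: "?\<phi> r = ?\<phi> s" if "perm_class Y r = perm_class Y s" "r \<in> ?P" "s \<in> ?P" for r s
    using sds_map_perm_rel[OF assms(1,2)] eq_equiv_class[OF _ equiv_perm_rel that(3)] that(1)
    by (simp add: perm_class_def)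
  have rot: "(?\<phi> r, ?\<phi> (rotate1 r)) \<in> ?R" "(?\<phi> (rotate1 r), ?\<phi> r) \<in> ?R" if "r \<in> ?P" for r
  proof -
    show "(?\<phi> r, ?\<phi> (rotate1 r)) \<in> ?R"
      using cycle_equivalent_rotate1[OF assms(1,2) that] that rotate1_permutation[OF that]
      by (auto simp: cycle_rel_def sds_maps_def)
    then show "(?\<phi> (rotate1 r), ?\<phi> r) \<in> ?R" by (rule symD[OF eqv(2)])
  qed
  have "perm_class Y p \<rightarrow>\<^sup>*\<^bsub>with_proj (mk_symmetric H)\<^esub> perm_class Y q"
    using H(2) p(2) q(2) by (auto simp: connected_def strongly_connected_def mk_symmetric_def)
  then have "(perm_class Y p, perm_class Y q) \<in>
      rtrancl_on (verts H) (arcs_ends (mk_symmetric H))"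
    by (simp add: reachable_def mk_symmetric_def)
  \<comment> \<open>The claim covers all representatives of the current endpoint, because the next
    arc is given by a representative \<open>r\<close> of its own choice.\<close>
  then have "\<forall>s\<in>?P. perm_class Y s = perm_class Y q \<longrightarrow> (?\<phi> p, ?\<phi> s) \<in> ?R"
  proof (induction rule: rtrancl_on_induct)
    case base
    have "(?\<phi> p, ?\<phi> p) \<in> ?R" by (rule refl_onD[OF eqv(1)]) (simp add: sds_maps_def p(1))
    then show ?case using same_class[OF _ _ p(1)] by metis
  next
    case (step c d)
    \<comment> \<open>An arc of the symmetric closure of \<open>H\<close> comes from an arc of
      \<open>H\<close> in one of the two orientations, hence from \<open>C_graph Y\<close>.\<close>
    have "(c, d) \<in> parcs (C_graph Y) \<or> (d, c) \<in> parcs (C_graph Y)"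
      using step.hyps H(1) by (auto simp: mk_symmetric_def subgraph_def compatible_def)
    then obtain r where r: "r \<in> ?P"
      and cd: "c = perm_class Y r \<and> d = perm_class Y (rotate1 r) \<or>
               c = perm_class Y (rotate1 r) \<and> d = perm_class Y r"
      by (auto simp: C_graph_def)
    note r' = rotate1_permutation[OF r]
    show ?case
    proof (intro ballI impI)
      fix s assume s: "s \<in> ?P" "perm_class Y s = d"
      from cd show "(?\<phi> p, ?\<phi> s) \<in> ?R"
      proof (elim disjE conjE)
        assume cd: "c = perm_class Y r" "d = perm_class Y (rotate1 r)"
        have "(?\<phi> p, ?\<phi> r) \<in> ?R" using step.IH r cd(1) by simp
        moreover have "?\<phi> s = ?\<phi> (rotate1 r)" using same_class[OF _ s(1) r'] s(2) cd(2) by simp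
        ultimately show ?thesis using transD[OF eqv(3)] rot(1)[OF r] by simp
      next
        assume cd: "c = perm_class Y (rotate1 r)" "d = perm_class Y r"
        have "(?\<phi> p, ?\<phi> (rotate1 r)) \<in> ?R" using step.IH r' cd(1) by simp
        moreover have "?\<phi> s = ?\<phi> r" using same_class[OF _ s(1) r] s(2) cd(2) by simp
        ultimately show ?thesis using transD[OF eqv(3)] rot(2)[OF r] by simp
      qed
    qed
  qed
  then show ?thesis using q(1) by blast
qed

theorem mainTheorem4:
  fixes n :: nat
    and Y :: "nat pair_pre_digraph"
    and K :: "'k set"
    and F :: "nat \<Rightarrow> (nat \<Rightarrow> 'k) \<Rightarrow> (nat \<Rightarrow> 'k)"
  assumes "pair_graph Y"
    and "pverts Y = {1..n}"
    and "finite K"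
    and "\<And>i. i \<in> {1..n} \<Longrightarrow> local_function Y K i (F i)"
  shows "card (cycle_equivalence_classes Y K F) \<le> \<kappa> Y"
proof -
  let ?G = "with_proj (C_graph Y)" and ?P = "permutations_of_set (pverts Y)"
  let ?R = "cycle_rel Y K F"
  have local: "\<And>i. i \<in> pverts Y \<Longrightarrow> local_function Y K i (F i)"
    using assms(2,4) by simp
  note eqv = equiv_cycle_rel[OF assms(1) local]
  interpret G: fin_digraph ?G by (rule fin_digraph_C_graph)
  have classes: "cycle_equivalence_classes Y K F = sds_maps Y K F // ?R"
    by (simp add: cycle_equivalence_classes_def cycle_rel_def)
  show ?thesis
    unfolding \<kappa>_def
  \<comment> \<open>A cycle class is related to every component containing a permutation class that
    realizes it. Each cycle class has such a component, and no component serves two cycle classes,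
    which bounds the number of cycle classes.\<close>
  proof (rule card_le_if_inj_on_rel[where r = "\<lambda>c H. \<exists>p\<in>?P. perm_class Y p \<in> verts H \<and>
        c = ?R `` {sds_map Y K F p}"])
    \<comment> \<open>Since \<open>card\<close> is 0 on infinite sets, the bound requires the set of
      components to be finite.\<close>
    show "finite (connected_components ?G)"
      by (rule finite_subset[OF _ G.finite_subgraphs])
        (auto simp: connected_components_def G.max_subgraph_def)
  next
    fix c assume "c \<in> cycle_equivalence_classes Y K F"
    then obtain p where p: "p \<in> ?P" "c = ?R `` {sds_map Y K F p}"
      by (auto simp: classes sds_maps_def elim!: quotientE)
    have "perm_class Y p \<in> verts ?G"
      using perm_class_in_quotient[OF p(1)] by (simp add: C_graph_def)
    then obtain H where "G.max_subgraph connected H" "perm_class Y p \<in> verts H"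
      by (rule G.vertex_in_component)
    with p show "\<exists>H. H \<in> connected_components ?G \<and>
        (\<exists>p\<in>?P. perm_class Y p \<in> verts H \<and> c = ?R `` {sds_map Y K F p})"
      by (auto simp: connected_components_def)
  next
    fix c d H
    assume "H \<in> connected_components ?G"
      and c: "\<exists>p\<in>?P. perm_class Y p \<in> verts H \<and> c = ?R `` {sds_map Y K F p}"
      and d: "\<exists>p\<in>?P. perm_class Y p \<in> verts H \<and> d = ?R `` {sds_map Y K F p}"
    then have H: "subgraph H ?G" "connected H"
      by (auto simp: connected_components_def G.max_subgraph_def)
    from c obtain p where p: "p \<in> ?P" "perm_class Y p \<in> verts H"
      and c_eq: "c = ?R `` {sds_map Y K F p}" by blast
    from d obtain q where q: "q \<in> ?P" "perm_class Y q \<in> verts H"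
      and d_eq: "d = ?R `` {sds_map Y K F q}" by blast
    show "c = d"
      unfolding c_eq d_eq
      by (rule equiv_class_eq[OF eqv cycle_rel_component[OF assms(1) local H p q]])
  qed
qed

end
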